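(* Fix a UGW measure with off-spring distribution $P$ of finite mean, such that $P([0,d_\star))=0$ for some $d_\star\ge3$, and let $\widehat\Delta$ be distributed according to $\widehat P_k:=(k+1)P_{k+1}/\sum_jjP_j$, $k\ge0$. For any fixed $\beta>\beta_c$ consider the recursion over $t\ge0$, $$h^{(t+1)}\stackrel{d}{=}\sum_{\ell=1}^{\widehat\Delta}\operatorname{atanh}\big[\tanh(\beta)\tanh(h_\ell^{(t)})\big],$$ where $h_\ell^{(t)}$ are i.i.d. copies of $h^{(t)}$ which are further independent of $\widehat\Delta$. Denote by $h^{\beta,+}$ its limit in law when $t\to\infty$, starting at $h^{(0)}=\infty$. Then, fixing any $\beta\ge\beta_0>\beta_\star$, where $\beta_\star=\operatorname{atanh}[(d_\star-1)^{-1}]$, and starting this recursion (at parameter $\beta$) at a stochastically dominating $h^{(0)}\succeq h^{\beta_0,+}$ yields a sequence $\{h^{(t)}\}$ that converges in law to $h^{\beta,+}$.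
   Context: The UGW measure with off-spring distribution $P=(P_k)_{k\ge0}$ is the law of the random rooted tree in which the root has a number of offspring of law $P$ and, independently, every other vertex has a number of offspring of law $\widehat P$. $\beta_c$ is the critical inverse temperature of the Ising model at zero magnetic field on the (almost every) UGW tree: there is a unique Ising Gibbs measure for $\beta<\beta_c$ and there are multiple ones for $\beta>\beta_c$. The convention $\tanh(\infty)=1$ is used, and $h\succeq h'$ means that the law of $h$ stochastically dominates that of $h'$. (Here $\beta_0>\beta_\star$ entails $\beta_0>\beta_c$, so $h^{\beta_0,+}$ is the limit law of the same recursion with $\beta_0$ in place of $\beta$.) *)

theory Defs
  imports "HOL-Probability.Probability"
begin

section \<open>The recursion\<close>

definition size_biased :: "nat pmf \<Rightarrow> nat pmf" where
  "size_biased P =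
     embed_pmf (\<lambda>k. real (k + 1) * pmf P (k + 1) / measure_pmf.expectation P real)"

definition tanh_ereal :: "ereal \<Rightarrow> real" where
  "tanh_ereal h = (if h = \<infinity> then 1 else if h = - \<infinity> then - 1 else tanh (real_of_ereal h))"

text \<open>
  The initial value of the recursion may be infinite, so it is given by a law on the extended reals.
  For finite \<open>\<beta>\<close> every summand below is finite, hence one step of the recursion always
  produces a law on the reals. The product measure expresses that the \<open>h l\<close> are i.i.d. with
  law \<open>\<mu>\<close> and independent of the number \<open>k\<close> of summands.
\<close>

definition recursion_step :: "nat pmf \<Rightarrow> real \<Rightarrow> ereal measure \<Rightarrow> real measure" where
  "recursion_step P \<beta> \<mu> =
     distr (measure_pmf (size_biased P) \<Otimes>\<^sub>M (\<Pi>\<^sub>M l\<in>(UNIV :: nat set). \<mu>)) borel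
       (\<lambda>(k, h). \<Sum>l<k. artanh (tanh \<beta> * tanh_ereal (h l)))"

primrec field_law :: "nat pmf \<Rightarrow> real \<Rightarrow> ereal measure \<Rightarrow> nat \<Rightarrow> ereal measure" where
  "field_law P \<beta> \<mu> 0 = \<mu>"
| "field_law P \<beta> \<mu> (Suc t) = distr (recursion_step P \<beta> (field_law P \<beta> \<mu> t)) borel ereal"

text \<open>
  Convergence in law of \<open>h\<^sup>(\<^sup>t\<^sup>+\<^sup>1\<^sup>)\<close> as \<open>t\<close> tends to infinity; the shift by one only
  leaves out the possibly infinite initial value, so that all laws involved live on the reals.
\<close>

definition recursion_tendsto :: "nat pmf \<Rightarrow> real \<Rightarrow> ereal measure \<Rightarrow> real measure \<Rightarrow> bool" where
  "recursion_tendsto P \<beta> \<mu> L \<longleftrightarrow>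
     real_distribution L \<and> weak_conv_m (\<lambda>t. recursion_step P \<beta> (field_law P \<beta> \<mu> t)) L"

text \<open>The law of \<open>h\<^sup>\<beta>\<^sup>,\<^sup>+\<close>: the limit of the recursion started at infinity.\<close>

definition plus_law :: "nat pmf \<Rightarrow> real \<Rightarrow> real measure" where
  "plus_law P \<beta> = (THE L. recursion_tendsto P \<beta> (return borel \<infinity>) L)"

definition stoch_dominates :: "ereal measure \<Rightarrow> ereal measure \<Rightarrow> bool" where
  "stoch_dominates \<mu> \<nu> \<longleftrightarrow> (\<forall>x. measure \<nu> {x<..} \<le> measure \<mu> {x<..})"


section \<open>The critical inverse temperature of the Ising model on the UGW tree\<close>

text \<open>
  A rooted tree in Ulam--Harris notation is encoded by its offspring counts: \<open>c v\<close> is the number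
  of children of the vertex \<open>v\<close>, the root is \<open>[]\<close>, and the children of \<open>v\<close> are \<open>v @ [i]\<close>
  for \<open>i < c v\<close>. Counts at labels that are not vertices of the tree are irrelevant.
\<close>

definition UGW :: "nat pmf \<Rightarrow> (nat list \<Rightarrow> nat) measure" where
  "UGW P = (\<Pi>\<^sub>M v\<in>UNIV. measure_pmf (if v = [] then P else size_biased P))"

definition tree_verts :: "(nat list \<Rightarrow> nat) \<Rightarrow> nat list set" where
  "tree_verts c = {v. \<forall>i<length v. v ! i < c (take i v)}"

definition spin_space :: "(nat list \<Rightarrow> nat) \<Rightarrow> (nat list \<Rightarrow> real) measure" where
  "spin_space c = (\<Pi>\<^sub>M v\<in>tree_verts c. count_space {- 1, 1})"

text \<open>
  The edges of the tree are the pairs \<open>(butlast v, v)\<close> with \<open>v\<close> a non-root vertex. The sum runs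
  over the edges with at least one end point in \<open>\<Lambda>\<close>.
\<close>

definition ising_weight ::
  "(nat list \<Rightarrow> nat) \<Rightarrow> real \<Rightarrow> nat list set \<Rightarrow> (nat list \<Rightarrow> real) \<Rightarrow> real" where
  "ising_weight c \<beta> \<Lambda> \<sigma> =
     exp (\<beta> * (\<Sum>v | v \<in> tree_verts c \<and> v \<noteq> [] \<and> (v \<in> \<Lambda> \<or> butlast v \<in> \<Lambda>).
                 \<sigma> (butlast v) * \<sigma> v))"

text \<open>The Ising specification: spins in \<open>\<Lambda>\<close> are resampled given the boundary condition \<open>\<sigma>\<close>.\<close>

definition ising_kernel ::
  "(nat list \<Rightarrow> nat) \<Rightarrow> real \<Rightarrow> nat list set \<Rightarrow> (nat list \<Rightarrow> real) \<Rightarrow> (nat list \<Rightarrow> real) set \<Rightarrow> real"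
where
  "ising_kernel c \<beta> \<Lambda> \<sigma> A =
     (let S = \<Lambda> \<rightarrow>\<^sub>E {- 1, 1 :: real}; glue = (\<lambda>s v. if v \<in> \<Lambda> then s v else \<sigma> v)
      in (\<Sum>s\<in>S. ising_weight c \<beta> \<Lambda> (glue s) * indicator A (glue s)) /
         (\<Sum>s\<in>S. ising_weight c \<beta> \<Lambda> (glue s)))"

definition ising_gibbs ::
  "(nat list \<Rightarrow> nat) \<Rightarrow> real \<Rightarrow> (nat list \<Rightarrow> real) measure \<Rightarrow> bool" where
  "ising_gibbs c \<beta> \<nu> \<longleftrightarrow>
     prob_space \<nu> \<and> sets \<nu> = sets (spin_space c) \<and>
     (\<forall>\<Lambda> A. finite \<Lambda> \<and> \<Lambda> \<subseteq> tree_verts c \<and> A \<in> sets \<nu> \<longrightarrow>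
        measure \<nu> A = (\<integral>\<sigma>. ising_kernel c \<beta> \<Lambda> \<sigma> A \<partial>\<nu>))"

definition ising_critical :: "nat pmf \<Rightarrow> real \<Rightarrow> bool" where
  "ising_critical P \<beta>c \<longleftrightarrow>
     0 \<le> \<beta>c \<and>
     (\<forall>\<beta>. 0 \<le> \<beta> \<and> \<beta> < \<beta>c \<longrightarrow> (AE c in UGW P. \<exists>!\<nu>. ising_gibbs c \<beta> \<nu>)) \<and>
     (\<forall>\<beta>. \<beta>c < \<beta> \<longrightarrow>
        (AE c in UGW P. \<exists>\<nu> \<nu>'. ising_gibbs c \<beta> \<nu> \<and> ising_gibbs c \<beta> \<nu>' \<and> \<nu> \<noteq> \<nu>'))"

end

theory Submission
  imports Defs
begin

text \<open>
  Put an independent label on every finite word over the naturals, consisting of an offspring count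
  with the size-biased law and an initial field of law \<open>\<mu>\<close>. Running the recursion from the words of
  length \<open>t\<close> down to the root realises \<open>h\<^sup>(\<^sup>t\<^sup>)\<close> as a function of the labels; the subtrees at the
  children of the root are independent copies of the whole tree, so this function has exactly the
  law of the recursion (\<open>field_law_eq_distr\<close>). Replacing the initial fields by \<open>\<infinity>\<close> uses
  the same offspring counts, so the recursions started from \<open>\<mu>\<close> and from \<open>\<infinity>\<close> live on one
  probability space and can be compared pointwise.

  The field started from \<open>\<infinity>\<close> decreases in \<open>t\<close> and is nonnegative. It therefore converges at every
  labelling, for every \<open>\<beta> \<ge> 0\<close>, and the law of its limit is the law of \<open>h\<^sup>\<beta>\<^sup>,\<^sup>+\<close>. It also dominates
  the field started from \<open>\<mu>\<close>, and only a matching lower bound has to be found.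

  Write \<open>f x = artanh (tanh \<beta> * tanh x)\<close> and let \<open>n = d_star - 1\<close>, which is a lower bound for the
  size-biased offspring counts. The slope of \<open>f\<close> at \<open>0\<close> is \<open>tanh \<beta>\<close>, so \<open>\<beta>\<^sub>0 > \<beta>_star\<close> says that
  the map \<open>n * f\<close> at parameter \<open>\<beta>\<^sub>0\<close> has slope above \<open>1\<close> at the origin and lifts some level \<open>c > 0\<close>
  (\<open>supercritical_branching_level\<close>). Hence the plus field at \<open>\<beta>\<^sub>0\<close> exceeds \<open>c\<close> almost surely, and so
  does the initial field, by stochastic domination. The level \<open>c\<close> is preserved by the recursion at
  \<open>\<beta> \<ge> \<beta>\<^sub>0\<close>.

  On \<open>[c, \<infinity>)\<close> strict concavity of \<open>f\<close> contracts ratios: if \<open>0 < r < 1\<close> then \<open>f (r * x) \<ge> r' * f x\<close>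
  for all \<open>x \<ge> c\<close>, with one factor \<open>r' > r\<close> (\<open>message_mult_ge\<close>). After one step the field started
  from \<open>\<mu>\<close> is at least \<open>f c / \<beta>\<close> times the plus field, because a sum of terms at least \<open>f c\<close> is
  compared with a sum of equally many terms \<open>\<beta>\<close>. Each further step improves the ratio from \<open>r\<close> to
  \<open>r'\<close>, and the iterates tend to \<open>1\<close> (\<open>improved_factor_iterates_tendsto_1\<close>). So at almost every labelling the
  field started from \<open>\<mu>\<close> is squeezed to the limit of the plus field
  (\<open>next_field_tendsto_plus_limit\<close>), which gives convergence in law.
\<close>

section \<open>Transmission of a field along one edge\<close>

text \<open>
  The contribution of one child to the field of its parent, the edge map \<open>f\<close> extended to
  infinite fields.
\<close>

definition message :: "real \<Rightarrow> ereal \<Rightarrow> real" where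
  "message \<beta> h = artanh (tanh \<beta> * tanh_ereal h)"

lemma artanh_mono:
  fixes x y :: real
  assumes "-1 < x" "x \<le> y" "y < 1"
  shows "artanh x \<le> artanh y"
proof -
  have "(1 + x) / (1 - x) \<le> (1 + y) / (1 - y)"
    using assms by (intro frac_le) auto
  moreover have "0 < (1 + x) / (1 - x)" using assms by simp
  ultimately show ?thesis unfolding artanh_def by (simp add: ln_mono)
qed

lemma tanh_ereal_ereal [simp]: "tanh_ereal (ereal x) = tanh x"
  and tanh_ereal_infty [simp]: "tanh_ereal \<infinity> = 1"
  by (simp_all add: tanh_ereal_def)

lemma tanh_ereal_mono: "x \<le> y \<Longrightarrow> tanh_ereal x \<le> tanh_ereal y"
  using tanh_real_lt_1 tanh_real_gt_neg1
  by (cases x; cases y) (auto simp: tanh_ereal_def less_imp_le)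

lemma abs_tanh_ereal_le_1: "\<bar>tanh_ereal x\<bar> \<le> 1"
  using tanh_real_lt_1 tanh_real_gt_neg1
  by (cases x) (auto simp: abs_le_iff less_imp_le minus_le_iff tanh_ereal_def)

lemma tanh_mult_tanh_ereal_bounds:
  shows "- 1 < tanh \<beta> * tanh_ereal x" "tanh \<beta> * tanh_ereal x < 1"
proof -
  have "\<bar>tanh \<beta> * tanh_ereal x\<bar> \<le> \<bar>tanh \<beta>\<bar>"
    using mult_left_mono[OF abs_tanh_ereal_le_1[of x], of "\<bar>tanh \<beta>\<bar>"] by (simp add: abs_mult)
  also have "\<dots> < 1"
    using tanh_real_bounds[of \<beta>] by (auto simp: abs_less_iff)
  finally show "- 1 < tanh \<beta> * tanh_ereal x" "tanh \<beta> * tanh_ereal x < 1"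
    by (auto simp: abs_less_iff)
qed

lemma message_mono: "0 \<le> \<beta> \<Longrightarrow> x \<le> y \<Longrightarrow> message \<beta> x \<le> message \<beta> y"
  unfolding message_def
  by (intro artanh_mono tanh_mult_tanh_ereal_bounds mult_left_mono tanh_ereal_mono) auto

lemma message_zero [simp]: "message \<beta> 0 = 0"
  by (simp add: message_def zero_ereal_def)

lemma message_infty [simp]: "message \<beta> \<infinity> = \<beta>"
  by (simp add: message_def artanh_tanh_real)

lemma message_nonneg: "0 \<le> \<beta> \<Longrightarrow> 0 \<le> x \<Longrightarrow> 0 \<le> message \<beta> x"
  using message_mono[of \<beta> 0 x] by simp

lemma message_le: "0 \<le> \<beta> \<Longrightarrow> message \<beta> x \<le> \<beta>"
  using message_mono[of \<beta> x \<infinity>] by simp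

lemma message_mono_temperature:
  assumes "\<beta>\<^sub>0 \<le> \<beta>" "0 \<le> x"
  shows "message \<beta>\<^sub>0 x \<le> message \<beta> x"
proof -
  have "0 \<le> tanh_ereal x"
    using tanh_ereal_mono[OF \<open>0 \<le> x\<close>] by (simp add: zero_ereal_def)
  then show ?thesis
    unfolding message_def using assms
    by (intro artanh_mono tanh_mult_tanh_ereal_bounds mult_right_mono) auto
qed

lemma measurable_message [measurable]: "message \<beta> \<in> borel_measurable borel"
  unfolding message_def tanh_ereal_def artanh_def tanh_def sinh_def cosh_def by measurable

lemma has_real_derivative_message:
  "((\<lambda>x. message \<beta> (ereal x)) has_real_derivative
     tanh \<beta> * (1 - (tanh x)\<^sup>2) / (1 - (tanh \<beta> * tanh x)\<^sup>2)) (at x)"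
proof -
  have "((\<lambda>x. tanh \<beta> * tanh x) has_real_derivative tanh \<beta> * (1 - (tanh x)\<^sup>2)) (at x)"
    by (auto intro!: derivative_eq_intros)
  moreover have "\<bar>tanh \<beta> * tanh x\<bar> < 1"
    using tanh_mult_tanh_ereal_bounds[of \<beta> "ereal x"] by (simp add: abs_less_iff)
  ultimately have "((\<lambda>x. artanh (tanh \<beta> * tanh x)) has_real_derivative
      1 / (1 - (tanh \<beta> * tanh x)\<^sup>2) * (tanh \<beta> * (1 - (tanh x)\<^sup>2))) (at x)"
    by (intro DERIV_chain2[OF artanh_real_has_field_derivative])
  then show ?thesis by (simp add: message_def)
qed

text \<open>
  The product \<open>n * tanh \<beta>\<close> is the slope at \<open>0\<close> of \<open>n\<close> times the edge map, which therefore lies above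
  the diagonal just to the right of \<open>0\<close>.
\<close>

lemma supercritical_branching_level:
  fixes \<beta> n :: real
  assumes "1 < n * tanh \<beta>"
  obtains c where "0 < c" "c < n * message \<beta> (ereal c)"
proof -
  have "((\<lambda>x. n * message \<beta> (ereal x) - x) has_real_derivative n * tanh \<beta> - 1) (at 0)"
    using has_real_derivative_message[of \<beta> 0]
    by (auto intro!: derivative_eq_intros)
  from DERIV_pos_inc_right[OF this] assms
  obtain d where "d > 0"
    and "\<And>h. 0 < h \<Longrightarrow> h < d \<Longrightarrow> n * message \<beta> (ereal 0) - 0 < n * message \<beta> (ereal (0 + h)) - (0 + h)"
    by force
  from this(1) this(2)[of "d/2"] show ?thesis
    by (intro that[of "d/2"]) (auto simp flip: zero_ereal_def)
qed

lemma tanh_gt_of_gt_artanh: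
  fixes x \<beta> :: real
  assumes "artanh x < \<beta>" "x < 1"
  shows "x < tanh \<beta>"
proof (rule ccontr)
  assume "\<not> x < tanh \<beta>"
  then have "artanh (tanh \<beta>) \<le> artanh x"
    using tanh_real_gt_neg1 assms by (intro artanh_mono) auto
  with assms show False by (simp add: artanh_tanh_real)
qed

section \<open>Improvement of a lower bound by strict concavity\<close>

text \<open>
  The edge map is strictly concave on \<open>[0, \<infinity>)\<close>. With \<open>s\<close>, \<open>t\<close>, \<open>u\<close> the squares of \<open>tanh \<beta>\<close>,
  \<open>tanh x\<close>, \<open>tanh y\<close>, the two sides of the inequality after clearing denominators differ by
  \<open>(1 - s) * (u - t)\<close>.
\<close>

lemma message_derivative_less:
  fixes \<beta> x y :: real
  assumes "0 < \<beta>" "0 \<le> x" "x < y"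
  shows "tanh \<beta> * (1 - (tanh y)\<^sup>2) / (1 - (tanh \<beta> * tanh y)\<^sup>2)
       < tanh \<beta> * (1 - (tanh x)\<^sup>2) / (1 - (tanh \<beta> * tanh x)\<^sup>2)"
proof -
  define s t u where "s = (tanh \<beta>)\<^sup>2" and "t = (tanh x)\<^sup>2" and "u = (tanh y)\<^sup>2"
  have "0 < s" "s < 1"
    using assms tanh_real_lt_1[of \<beta>] by (auto simp: s_def power_less_one_iff abs_square_less_1)
  have "t < u"
    unfolding t_def u_def using assms by (intro power_strict_mono) auto
  have "0 \<le> t" by (simp add: t_def)
  have "u < 1"
    using assms tanh_real_lt_1[of y] by (auto simp: u_def power_less_one_iff abs_square_less_1)
  have pos: "0 < 1 - s * u" "0 < 1 - s * t"
    using \<open>0 < s\<close> \<open>s < 1\<close> \<open>u < 1\<close> \<open>t < u\<close> \<open>0 \<le> t\<close>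
    by (smt (verit) mult_left_le mult_nonneg_nonneg)+
  have "0 < (1 - s) * (u - t)" using \<open>s < 1\<close> \<open>t < u\<close> by simp
  then have "(1 - u) * (1 - s * t) < (1 - t) * (1 - s * u)"
    by (simp add: algebra_simps)
  then have "(1 - u) / (1 - s * u) < (1 - t) / (1 - s * t)"
    using pos by (simp add: divide_simps mult.commute)
  then have "tanh \<beta> * ((1 - u) / (1 - s * u)) < tanh \<beta> * ((1 - t) / (1 - s * t))"
    using assms by (intro mult_strict_left_mono) auto
  then show ?thesis by (simp add: s_def t_def u_def power_mult_distrib)
qed

lemma has_real_derivative_message_gain:
  "((\<lambda>x. message \<beta> (ereal (r * x)) - r * message \<beta> (ereal x)) has_real_derivative
     r * (tanh \<beta> * (1 - (tanh (r * x))\<^sup>2) / (1 - (tanh \<beta> * tanh (r * x))\<^sup>2)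
        - tanh \<beta> * (1 - (tanh x)\<^sup>2) / (1 - (tanh \<beta> * tanh x)\<^sup>2))) (at x)"
proof -
  have "((\<lambda>x. message \<beta> (ereal (r * x))) has_real_derivative
     tanh \<beta> * (1 - (tanh (r * x))\<^sup>2) / (1 - (tanh \<beta> * tanh (r * x))\<^sup>2) * r) (at x)"
    by (rule DERIV_chain2[OF has_real_derivative_message]) (auto intro!: derivative_eq_intros)
  then show ?thesis
    by (rule DERIV_cong[OF DERIV_diff[OF _ DERIV_cmult[OF has_real_derivative_message]]])
       (simp add: algebra_simps)
qed

text \<open>
  The gain of \<open>f (r * x)\<close> over the linear bound \<open>r * f x\<close> has derivative
  \<open>r * (f' (r * x) - f' x)\<close>, which is positive since \<open>f'\<close> is decreasing. The gain at a level \<open>c\<close> is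
  thus a lower bound for the gain at every larger field.
\<close>

lemma message_gain_strict_mono:
  fixes \<beta> r x y :: real
  assumes "0 < \<beta>" "0 < r" "r < 1" "0 \<le> x" "x < y"
  shows "message \<beta> (ereal (r * x)) - r * message \<beta> (ereal x)
       < message \<beta> (ereal (r * y)) - r * message \<beta> (ereal y)"
proof (rule DERIV_pos_imp_increasing_open[OF \<open>x < y\<close>])
  fix z assume z: "x < z" "z < y"
  have "r * z < z" "0 \<le> r * z" using assms z by auto
  then have "0 < r * (tanh \<beta> * (1 - (tanh (r * z))\<^sup>2) / (1 - (tanh \<beta> * tanh (r * z))\<^sup>2)
      - tanh \<beta> * (1 - (tanh z)\<^sup>2) / (1 - (tanh \<beta> * tanh z)\<^sup>2))"
    using message_derivative_less[of \<beta> "r * z" z] assms by (intro mult_pos_pos) auto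
  then show "\<exists>D. ((\<lambda>x. message \<beta> (ereal (r * x)) - r * message \<beta> (ereal x))
      has_real_derivative D) (at z) \<and> 0 < D"
    using has_real_derivative_message_gain by blast
next
  show "continuous_on {x..y} (\<lambda>x. message \<beta> (ereal (r * x)) - r * message \<beta> (ereal x))"
    using has_real_derivative_message_gain
    by (intro continuous_at_imp_continuous_on ballI DERIV_isCont) blast
qed

text \<open>
  The gain at \<open>c\<close>, relative to the upper bound \<open>\<beta>\<close> of the edge map, is added to the ratio. Dividing
  by \<open>\<beta>\<close> is what makes one factor serve all fields above \<open>c\<close>, however large.
\<close>

definition improved_factor :: "real \<Rightarrow> real \<Rightarrow> real \<Rightarrow> real" where
  "improved_factor \<beta> c r =
     r + (message \<beta> (ereal (r * c)) - r * message \<beta> (ereal c)) / \<beta>"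

lemma improved_factor_1 [simp]: "improved_factor \<beta> c 1 = 1"
  by (simp add: improved_factor_def)

text \<open>
  The gain at \<open>x\<close> is at least the gain at \<open>c\<close>, and the latter is at least its share
  \<open>f x / \<beta> \<le> 1\<close>.
\<close>

lemma message_mult_ge:
  fixes \<beta> r c x :: real
  assumes "0 < \<beta>" "0 < r" "r \<le> 1" "0 < c" "c \<le> x"
  shows "improved_factor \<beta> c r * message \<beta> (ereal x) \<le> message \<beta> (ereal (r * x))"
proof (cases "r = 1")
  case True
  then show ?thesis by (simp add: improved_factor_def)
next
  case False
  define \<delta> where "\<delta> = message \<beta> (ereal (r * c)) - r * message \<beta> (ereal c)"
  have "0 \<le> \<delta>"
    using message_gain_strict_mono[of \<beta> r 0 c] assms False
    by (simp add: \<delta>_def flip: zero_ereal_def)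
  have "\<delta> / \<beta> * message \<beta> (ereal x) \<le> \<delta> / \<beta> * \<beta>"
    using \<open>0 \<le> \<delta>\<close> assms by (intro mult_left_mono message_le) auto
  also have "\<dots> = \<delta>" using assms by simp
  also have "\<delta> \<le> message \<beta> (ereal (r * x)) - r * message \<beta> (ereal x)"
    using message_gain_strict_mono[of \<beta> r c x] assms False
    by (cases "c = x") (auto simp: \<delta>_def)
  finally show ?thesis
    by (simp add: improved_factor_def \<delta>_def algebra_simps)
qed

lemma improved_factor_greater:
  assumes "0 < \<beta>" "0 < c" "0 < r" "r < 1"
  shows "r < improved_factor \<beta> c r"
  using message_gain_strict_mono[of \<beta> r 0 c] assms
  by (simp add: improved_factor_def flip: zero_ereal_def)

lemma improved_factor_le_1:
  assumes "0 < \<beta>" "0 < c" "0 < r" "r \<le> 1"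
  shows "improved_factor \<beta> c r \<le> 1"
proof -
  have "r * c \<le> c" using assms by simp
  have "message \<beta> (ereal (r * c)) - r * message \<beta> (ereal c) \<le> (1 - r) * message \<beta> (ereal c)"
    using message_mono[of \<beta> "ereal (r * c)" "ereal c"] assms \<open>r * c \<le> c\<close>
    by (simp add: algebra_simps)
  also have "\<dots> \<le> (1 - r) * \<beta>"
    using assms by (intro mult_left_mono message_le) auto
  finally show ?thesis using assms by (simp add: improved_factor_def field_simps)
qed

lemma isCont_improved_factor: "0 < \<beta> \<Longrightarrow> isCont (improved_factor \<beta> c) r"
proof -
  assume "0 < \<beta>"
  have "isCont (\<lambda>x. message \<beta> (ereal x)) z" for z
    using has_real_derivative_message by (rule DERIV_isCont)
  then have "isCont (\<lambda>r. message \<beta> (ereal (r * c))) r"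
    using continuous_at_compose[of r "\<lambda>r. r * c" "\<lambda>x. message \<beta> (ereal x)"] by (simp add: o_def)
  then show ?thesis
    unfolding improved_factor_def using \<open>0 < \<beta>\<close> by (intro continuous_intros) auto
qed

lemma improved_factor_iterates:
  assumes "0 < \<beta>" "0 < c" "0 < r" "r \<le> 1"
  shows "0 < (improved_factor \<beta> c ^^ t) r \<and> (improved_factor \<beta> c ^^ t) r \<le> 1"
proof (induction t)
  case (Suc t)
  define q where "q = (improved_factor \<beta> c ^^ t) r"
  have "0 < q" "q \<le> 1" using Suc by (auto simp: q_def)
  then have "0 < improved_factor \<beta> c q \<and> improved_factor \<beta> c q \<le> 1"
    using improved_factor_greater[of \<beta> c q] improved_factor_le_1[of \<beta> c q] assms
    by (cases "q = 1") auto
  then show ?case by (simp add: q_def)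
qed (use assms in simp)

text \<open>
  The iterates increase, and their limit is a positive fixed point of a continuous map that moves
  every point of \<open>(0, 1)\<close>.
\<close>

lemma improved_factor_iterates_tendsto_1:
  assumes "0 < \<beta>" "0 < c" "0 < r" "r \<le> 1"
  shows "(\<lambda>t. (improved_factor \<beta> c ^^ t) r) \<longlonglongrightarrow> 1"
proof -
  define a where "a t = (improved_factor \<beta> c ^^ t) r" for t
  have a_Suc: "a (Suc t) = improved_factor \<beta> c (a t)" for t by (simp add: a_def)
  have a: "0 < a t" "a t \<le> 1" for t
    using improved_factor_iterates[OF assms] by (auto simp: a_def)
  have le: "a t \<le> a (Suc t)" for t
    using improved_factor_greater[of \<beta> c "a t"] a[of t] assms
    by (cases "a t = 1") (auto simp: a_Suc)
  then have "incseq a" by (rule incseq_SucI)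
  then obtain L where L: "a \<longlonglongrightarrow> L" "\<And>t. a t \<le> L"
    using incseq_convergent[of a 1] a by blast
  have "0 < L" using a(1)[of 0] L(2)[of 0] by linarith
  have "L \<le> 1" using L(1) a(2) by (intro LIMSEQ_le_const2) auto
  have "(\<lambda>t. improved_factor \<beta> c (a t)) \<longlonglongrightarrow> improved_factor \<beta> c L"
    using isCont_improved_factor[OF assms(1)] L(1) by (rule isCont_tendsto_compose)
  moreover have "(\<lambda>t. improved_factor \<beta> c (a t)) \<longlonglongrightarrow> L"
    using LIMSEQ_Suc[OF L(1)] by (simp add: a_Suc)
  ultimately have "improved_factor \<beta> c L = L" by (rule LIMSEQ_unique)
  then have "L = 1"
    using improved_factor_greater[of \<beta> c L] assms \<open>0 < L\<close> \<open>L \<le> 1\<close> by fastforce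
  with L(1) show ?thesis by (simp add: a_def[abs_def])
qed

section \<open>The size-biased offspring law\<close>

text \<open>
  The weights defining the size-biased law sum to one, which is what gives the embedded mass function
  its intended values.
\<close>

lemma size_biased_density:
  assumes "integrable (measure_pmf P) real" "0 < measure_pmf.expectation P real"
  shows "(\<integral>\<^sup>+k. ennreal (real (k + 1) * pmf P (k + 1) / measure_pmf.expectation P real)
            \<partial>count_space UNIV) = 1"
proof -
  define E where "E = measure_pmf.expectation P real"
  have "ennreal E = (\<integral>\<^sup>+k. ennreal (real k) \<partial>measure_pmf P)"
    unfolding E_def using assms(1) by (intro nn_integral_eq_integral[symmetric]) auto
  also have "\<dots> = (\<Sum>k. ennreal (real k * pmf P k))"
    by (simp add: nn_integral_measure_pmf nn_integral_count_space_nat mult.commute ennreal_mult'')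
  also have "\<dots> = (\<Sum>k. ennreal (real (k + 1) * pmf P (k + 1)))"
    by (subst suminf_offset[of _ 1]) auto
  finally have E: "(\<Sum>k. ennreal (real (k + 1) * pmf P (k + 1))) = ennreal E" ..
  have "(\<integral>\<^sup>+k. ennreal (real (k + 1) * pmf P (k + 1) / E) \<partial>count_space UNIV)
      = (\<Sum>k. ennreal (real (k + 1) * pmf P (k + 1)) / ennreal E)"
    unfolding nn_integral_count_space_nat using assms(2)
    by (intro suminf_cong divide_ennreal[symmetric]) (auto simp: E_def)
  also have "\<dots> = ennreal E / ennreal E"
    by (simp only: divide_ennreal_def ennreal_suminf_multc E)
  also have "\<dots> = 1"
    using assms(2) by (simp add: divide_ennreal E_def)
  finally show ?thesis by (simp add: E_def)
qed

lemma size_biased_support: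
  assumes int: "integrable (measure_pmf P) real"
    and null: "measure_pmf.prob P {0..<d} = 0" and "0 < d"
    and k: "k \<in> set_pmf (size_biased P)"
  shows "d - 1 \<le> k"
proof -
  have supp: "d \<le> j" if "j \<in> set_pmf P" for j
    using measure_pmf_posI[OF that, of "{0..<d}"] null by force
  have "real d = measure_pmf.expectation P (\<lambda>_. real d)" by simp
  also have "\<dots> \<le> measure_pmf.expectation P real"
    using int supp by (intro integral_mono_AE) (auto simp: AE_measure_pmf_iff)
  finally have E: "0 < measure_pmf.expectation P real" using \<open>0 < d\<close> by simp
  have "set_pmf (size_biased P)
      = {k. real (k + 1) * pmf P (k + 1) / measure_pmf.expectation P real \<noteq> 0}"
    unfolding size_biased_def using E
    by (intro set_embed_pmf size_biased_density int) auto
  then have "k + 1 \<in> set_pmf P"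
    using k E by (auto simp: set_pmf_iff)
  with supp show ?thesis by fastforce
qed

section \<open>Independently labelled trees\<close>

text \<open>
  The child index is put at the front of a word, so that the subtree at a child is again a labelling
  of all words and the recursion can pass from a tree to its subtrees at the root.
\<close>

definition subtree :: "nat \<Rightarrow> (nat list \<Rightarrow> 'a) \<Rightarrow> nat list \<Rightarrow> 'a" where
  "subtree l \<omega> = (\<lambda>v. \<omega> (l # v))"

abbreviation tree_space :: "'a measure \<Rightarrow> (nat list \<Rightarrow> 'a) measure" where
  "tree_space M \<equiv> \<Pi>\<^sub>M v\<in>UNIV. M"

lemma measurable_subtree [measurable]: "subtree l \<in> tree_space M \<rightarrow>\<^sub>M tree_space M"
  unfolding subtree_def by (rule measurable_PiM_single') (auto simp: space_PiM PiE_def)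

lemma distr_subtree:
  assumes "prob_space M"
  shows "distr (tree_space M) (tree_space M) (subtree l) = tree_space M"
  using distr_PiM_reindex[of UNIV "\<lambda>_. M" "\<lambda>v. l # v" UNIV] assms
  by (simp add: subtree_def[abs_def] restrict_def)

lemma indep_vars_labels:
  assumes "prob_space M"
  shows "prob_space.indep_vars (tree_space M) (\<lambda>_. M) (\<lambda>v \<omega>. \<omega> v) UNIV"
proof -
  interpret prob_space "tree_space M" by (intro prob_space_PiM assms)
  have "distr (tree_space M) M (\<lambda>\<omega>. \<omega> v) = M" for v :: "nat list"
    using assms by (intro distr_PiM_component) auto
  then show ?thesis
    by (subst indep_vars_iff_distr_eq_PiM) (auto simp: restrict_def)
qed

text \<open>
  The self-similarity of the labelled tree: its root label and its subtrees at the children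
  are independent, and each subtree is distributed as the tree itself. Every step of the distributional
  recursion is read off from this.
\<close>

lemma distr_root_subtrees:
  fixes f :: "'a \<Rightarrow> 'b" and X :: "(nat list \<Rightarrow> 'a) \<Rightarrow> 'c"
  assumes M: "prob_space M"
    and f [measurable]: "f \<in> M \<rightarrow>\<^sub>M K" and X [measurable]: "X \<in> tree_space M \<rightarrow>\<^sub>M N"
  shows "distr (tree_space M) (K \<Otimes>\<^sub>M (\<Pi>\<^sub>M l\<in>(UNIV :: nat set). N))
           (\<lambda>\<omega>. (f (\<omega> []), \<lambda>l. X (subtree l \<omega>)))
       = distr M K f \<Otimes>\<^sub>M (\<Pi>\<^sub>M l\<in>(UNIV :: nat set). distr (tree_space M) N X)"
proof -
  interpret T: prob_space "tree_space M" by (intro prob_space_PiM M)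
  have sub [measurable]: "subtree l \<in> (\<Pi>\<^sub>M v\<in>A. M) \<rightarrow>\<^sub>M tree_space M" if "range ((#) l) \<subseteq> A" for l A
    unfolding subtree_def using that
    by (intro measurable_PiM_single' measurable_component_singleton) (auto simp: space_PiM PiE_def)
  \<comment> \<open>The subtrees at distinct children use disjoint sets of labels.\<close>
  have "T.indep_vars (\<lambda>l. \<Pi>\<^sub>M v\<in>range ((#) l). M)
      (\<lambda>l \<omega>. restrict (\<lambda>v. \<omega> v) (range ((#) l))) UNIV"
    by (rule T.indep_vars_restrict[OF indep_vars_labels[OF M]]) (auto simp: disjoint_family_on_def)
  then have "T.indep_vars (\<lambda>_. N)
      (\<lambda>l. (\<lambda>\<rho>. X (subtree l \<rho>)) \<circ> (\<lambda>\<omega>. restrict (\<lambda>v. \<omega> v) (range ((#) l)))) UNIV"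
    by (rule T.indep_vars_compose) (auto intro!: measurable_compose[OF sub X])
  moreover have "X (subtree l (restrict (\<lambda>v. \<omega> v) (range ((#) l)))) = X (subtree l \<omega>)" for l \<omega>
    by (simp add: subtree_def)
  ultimately have "T.indep_vars (\<lambda>_. N) (\<lambda>l \<omega>. X (subtree l \<omega>)) UNIV"
    by (simp add: o_def)
  then have joint: "distr (tree_space M) (\<Pi>\<^sub>M l\<in>(UNIV :: nat set). N) (\<lambda>\<omega> l. X (subtree l \<omega>))
      = (\<Pi>\<^sub>M l\<in>(UNIV :: nat set). distr (tree_space M) N (\<lambda>\<omega>. X (subtree l \<omega>)))"
    by (subst (asm) T.indep_vars_iff_distr_eq_PiM) (auto simp: restrict_def)
  have "distr (tree_space M) N (\<lambda>\<omega>. X (subtree l \<omega>)) = distr (tree_space M) N X" for l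
  proof -
    have "distr (tree_space M) N (\<lambda>\<omega>. X (subtree l \<omega>))
        = distr (distr (tree_space M) (tree_space M) (subtree l)) N X"
      by (simp add: distr_distr o_def)
    then show ?thesis by (simp add: distr_subtree M)
  qed
  with joint have children: "distr (tree_space M) (\<Pi>\<^sub>M l\<in>(UNIV :: nat set). N)
      (\<lambda>\<omega> l. X (subtree l \<omega>)) = (\<Pi>\<^sub>M l\<in>(UNIV :: nat set). distr (tree_space M) N X)"
    by simp
  have "distr (tree_space M) K (\<lambda>\<omega>. f (\<omega> [])) = distr (distr (tree_space M) M (\<lambda>\<omega>. \<omega> [])) K f"
    by (simp add: distr_distr o_def)
  also have "\<dots> = distr M K f" using M by (subst distr_PiM_component) auto
  finally have root: "distr (tree_space M) K (\<lambda>\<omega>. f (\<omega> [])) = distr M K f" .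
  \<comment> \<open>The root label is not used by any of the subtrees at its children.\<close>
  let ?R = "\<Pi>\<^sub>M v\<in>{[] :: nat list}. M" and ?D = "\<Pi>\<^sub>M v\<in>-{[] :: nat list}. M"
  let ?r = "\<lambda>\<omega> :: nat list \<Rightarrow> 'a. restrict (\<lambda>v. \<omega> v) {[]}"
  let ?d = "\<lambda>\<omega> :: nat list \<Rightarrow> 'a. restrict (\<lambda>v. \<omega> v) (-{[]})"
  have "T.indep_var ?R ?r ?D ?d"
    by (rule T.indep_var_restrict[OF indep_vars_labels[OF M]]) auto
  then have indep: "distr (tree_space M) ?R ?r \<Otimes>\<^sub>M distr (tree_space M) ?D ?d
      = distr (tree_space M) (?R \<Otimes>\<^sub>M ?D) (\<lambda>\<omega>. (?r \<omega>, ?d \<omega>))"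
    and [measurable]: "?r \<in> tree_space M \<rightarrow>\<^sub>M ?R" "?d \<in> tree_space M \<rightarrow>\<^sub>M ?D"
    by (simp_all add: T.indep_var_distribution_eq)
  have [measurable]: "(\<lambda>\<rho> l. X (subtree l \<rho>)) \<in> ?D \<rightarrow>\<^sub>M (\<Pi>\<^sub>M l\<in>(UNIV :: nat set). N)"
  proof -
    have child: "(\<lambda>\<rho>. X (subtree l \<rho>)) \<in> ?D \<rightarrow>\<^sub>M N" for l
      by (rule measurable_compose[OF sub X]) auto
    show ?thesis
      using measurable_space[OF child]
      by (intro measurable_PiM_single' child) (auto simp: PiE_def)
  qed
  have [measurable]: "(\<lambda>\<rho>. f (\<rho> [])) \<in> ?R \<rightarrow>\<^sub>M K"
    by measurable
  have restr: "subtree l (?d \<omega>) = subtree l \<omega>" for l \<omega>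
    by (simp add: subtree_def)
  have "distr (tree_space M) K (\<lambda>\<omega>. f (\<omega> []))
      = distr (distr (tree_space M) ?R ?r) K (\<lambda>\<rho>. f (\<rho> []))"
    by (simp add: distr_distr o_def)
  moreover have "distr (tree_space M) (\<Pi>\<^sub>M l\<in>(UNIV :: nat set). N) (\<lambda>\<omega> l. X (subtree l \<omega>))
      = distr (distr (tree_space M) ?D ?d) (\<Pi>\<^sub>M l\<in>(UNIV :: nat set). N) (\<lambda>\<rho> l. X (subtree l \<rho>))"
    by (simp add: distr_distr o_def restr)
  moreover have "prob_space (\<Pi>\<^sub>M l\<in>(UNIV :: nat set). distr (tree_space M) N X)"
    by (intro prob_space_PiM T.prob_space_distr X)
  ultimately have "distr M K f \<Otimes>\<^sub>M (\<Pi>\<^sub>M l\<in>(UNIV :: nat set). distr (tree_space M) N X)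
      = distr (distr (tree_space M) ?R ?r \<Otimes>\<^sub>M distr (tree_space M) ?D ?d)
          (K \<Otimes>\<^sub>M (\<Pi>\<^sub>M l\<in>(UNIV :: nat set). N)) (\<lambda>(\<rho>, \<rho>'). (f (\<rho> []), \<lambda>l. X (subtree l \<rho>')))"
    unfolding root[symmetric] children[symmetric]
    by (simp add: pair_measure_distr prob_space_imp_sigma_finite)
  also have "\<dots> = distr (tree_space M) (K \<Otimes>\<^sub>M (\<Pi>\<^sub>M l\<in>(UNIV :: nat set). N))
      (\<lambda>\<omega>. (f (\<omega> []), \<lambda>l. X (subtree l \<omega>)))"
    unfolding indep by (subst distr_distr) (auto simp: o_def restr)
  finally show ?thesis ..
qed

section \<open>The recursion along a fixed labelled tree\<close>

text \<open>
  The transformation \<open>g\<close> acts on the initial fields only; with \<open>g\<close> the identity or constantly \<open>\<infinity>\<close>,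
  one labelling carries the recursions from both initial laws.
\<close>

primrec root_field ::
  "real \<Rightarrow> (ereal \<Rightarrow> ereal) \<Rightarrow> nat \<Rightarrow> (nat list \<Rightarrow> nat \<times> ereal) \<Rightarrow> ereal" where
  "root_field \<beta> g 0 \<omega> = g (snd (\<omega> []))"
| "root_field \<beta> g (Suc t) \<omega> =
     ereal (\<Sum>l<fst (\<omega> []). message \<beta> (root_field \<beta> g t (subtree l \<omega>)))"

text \<open>
  The value after \<open>t + 1\<close> steps as a real number; only the initial value can be infinite.
\<close>

definition next_field ::
  "real \<Rightarrow> (ereal \<Rightarrow> ereal) \<Rightarrow> nat \<Rightarrow> (nat list \<Rightarrow> nat \<times> ereal) \<Rightarrow> real" where
  "next_field \<beta> g t \<omega> = (\<Sum>l<fst (\<omega> []). message \<beta> (root_field \<beta> g t (subtree l \<omega>)))"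

lemma root_field_Suc: "root_field \<beta> g (Suc t) = (\<lambda>\<omega>. ereal (next_field \<beta> g t \<omega>))"
  by (simp add: next_field_def fun_eq_iff)

abbreviation plus_field :: "real \<Rightarrow> nat \<Rightarrow> (nat list \<Rightarrow> nat \<times> ereal) \<Rightarrow> real" where
  "plus_field \<beta> \<equiv> next_field \<beta> (\<lambda>_. \<infinity>)"

definition plus_limit :: "real \<Rightarrow> (nat list \<Rightarrow> nat \<times> ereal) \<Rightarrow> real" where
  "plus_limit \<beta> \<omega> = lim (\<lambda>t. plus_field \<beta> t \<omega>)"

lemma next_field_mono:
  assumes "0 \<le> \<beta>"
    and "\<And>l. root_field \<beta> g s (subtree l \<omega>) \<le> root_field \<beta> h t (subtree l \<omega>)"
  shows "next_field \<beta> g s \<omega> \<le> next_field \<beta> h t \<omega>"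
  unfolding next_field_def using assms by (intro sum_mono message_mono) auto

lemma root_field_nonneg:
  assumes "0 \<le> \<beta>" "\<And>x. 0 \<le> g x"
  shows "0 \<le> root_field \<beta> g t \<omega>"
proof (induction t arbitrary: \<omega>)
  case (Suc t)
  then show ?case using assms by (auto intro!: sum_nonneg message_nonneg)
qed (use assms in simp)

text \<open>
  The first step goes down from \<open>\<infinity>\<close>, and monotonicity of the edge map passes this on.
\<close>

lemma plus_root_field_antimono:
  assumes "0 \<le> \<beta>"
  shows "root_field \<beta> (\<lambda>_. \<infinity>) (Suc t) \<omega> \<le> root_field \<beta> (\<lambda>_. \<infinity>) t \<omega>"
proof (induction t arbitrary: \<omega>)
  case (Suc t)
  have "plus_field \<beta> (Suc t) \<omega> \<le> plus_field \<beta> t \<omega>"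
    using assms Suc by (intro next_field_mono)
  then show ?case by (simp add: root_field_Suc del: root_field.simps)
qed simp

lemma plus_field_tendsto:
  assumes "0 \<le> \<beta>"
  shows "(\<lambda>t. plus_field \<beta> t \<omega>) \<longlonglongrightarrow> plus_limit \<beta> \<omega>"
proof -
  have "decseq (\<lambda>t. plus_field \<beta> t \<omega>)"
    using plus_root_field_antimono[OF assms, of "Suc _" \<omega>]
    by (intro decseq_SucI) (simp add: root_field_Suc del: root_field.simps)
  moreover have "0 \<le> plus_field \<beta> t \<omega>" for t
    using root_field_nonneg[OF assms, of "\<lambda>_. \<infinity>" "Suc t" \<omega>]
    by (simp add: root_field_Suc del: root_field.simps)
  ultimately have "convergent (\<lambda>t. plus_field \<beta> t \<omega>)"
    by (metis decseq_convergent convergentI)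
  then show ?thesis by (simp add: plus_limit_def convergent_LIMSEQ_iff)
qed

lemma root_field_le_plus:
  assumes "0 \<le> \<beta>"
  shows "root_field \<beta> g t \<omega> \<le> root_field \<beta> (\<lambda>_. \<infinity>) t \<omega>"
proof (induction t arbitrary: \<omega>)
  case (Suc t)
  then show ?case using assms by (auto intro!: sum_mono message_mono)
qed simp

text \<open>
  The bound is imposed at every word, vertex of the tree or not, so that it passes to subtrees.
\<close>

definition offspring_at_least :: "nat \<Rightarrow> (nat list \<Rightarrow> nat \<times> ereal) \<Rightarrow> bool" where
  "offspring_at_least n \<omega> \<longleftrightarrow> (\<forall>v. n \<le> fst (\<omega> v))"

lemma offspring_at_least_subtree: "offspring_at_least n \<omega> \<Longrightarrow> offspring_at_least n (subtree l \<omega>)"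
  by (simp add: offspring_at_least_def subtree_def)

lemma next_field_ge:
  assumes "0 \<le> \<beta>" "n \<le> fst (\<omega> [])" "0 \<le> c" "\<And>l. ereal c \<le> root_field \<beta> g t (subtree l \<omega>)"
  shows "real n * message \<beta> (ereal c) \<le> next_field \<beta> g t \<omega>"
proof -
  have "real n * message \<beta> (ereal c) \<le> (\<Sum>l<fst (\<omega> []). message \<beta> (ereal c))"
    using assms message_nonneg[of \<beta> "ereal c"] by (auto intro!: mult_right_mono)
  also have "\<dots> \<le> next_field \<beta> g t \<omega>"
    unfolding next_field_def using assms by (intro sum_mono message_mono) auto
  finally show ?thesis .
qed

lemma root_field_ge:
  assumes "0 \<le> \<beta>" "0 \<le> c" "c \<le> real n * message \<beta> (ereal c)"
    and "offspring_at_least n \<omega>" "\<And>v. ereal c \<le> g (snd (\<omega> v))"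
  shows "ereal c \<le> root_field \<beta> g t \<omega>"
  using assms(4,5)
proof (induction t arbitrary: \<omega>)
  case (Suc t)
  have "real n * message \<beta> (ereal c) \<le> next_field \<beta> g t \<omega>"
    using Suc.prems offspring_at_least_subtree[OF Suc.prems(1)]
    by (intro next_field_ge Suc.IH assms) (auto simp: offspring_at_least_def subtree_def)
  then show ?case using assms(3) by (simp add: root_field_Suc del: root_field.simps)
qed simp

text \<open>
  The basis is the comparison of summands \<open>f c\<close> and \<open>\<beta>\<close>. In the inductive step the ratio improves at each child
  separately, because the plus field of the child's subtree is above the level \<open>c\<close>; the improved
  ratio is the same for all children and survives summation.
\<close>

lemma next_field_ge_plus:
  assumes \<beta>: "0 < \<beta>" and c: "0 < c" "c \<le> real n * message \<beta> (ereal c)"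
    and \<omega>: "offspring_at_least n \<omega>" "\<And>v. ereal c \<le> g (snd (\<omega> v))"
  shows "(improved_factor \<beta> c ^^ t) (message \<beta> (ereal c) / \<beta>) * plus_field \<beta> t \<omega> \<le> next_field \<beta> g t \<omega>"
  using \<omega>
proof (induction t arbitrary: \<omega>)
  case 0
  have "message \<beta> (ereal c) / \<beta> * plus_field \<beta> 0 \<omega> = (\<Sum>l<fst (\<omega> []). message \<beta> (ereal c))"
    using \<beta> by (simp add: next_field_def)
  also have "\<dots> \<le> next_field \<beta> g 0 \<omega>"
    unfolding next_field_def using \<beta> 0 by (intro sum_mono message_mono) (auto simp: subtree_def)
  finally show ?case by simp
next
  case (Suc t)
  define r where "r = (improved_factor \<beta> c ^^ t) (message \<beta> (ereal c) / \<beta>)"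
  have "0 < message \<beta> (ereal c)"
    using c by (smt (verit) mult_nonneg_nonpos of_nat_0_le_iff)
  then have r: "0 < r" "r \<le> 1"
    using improved_factor_iterates[of \<beta> c "message \<beta> (ereal c) / \<beta>" t] \<beta> c message_le[of \<beta> "ereal c"]
    by (auto simp: r_def)
  have "improved_factor \<beta> c r * plus_field \<beta> (Suc t) \<omega>
      = (\<Sum>l<fst (\<omega> []). improved_factor \<beta> c r * message \<beta> (ereal (plus_field \<beta> t (subtree l \<omega>))))"
    by (subst next_field_def) (simp add: root_field_Suc sum_distrib_left del: root_field.simps)
  also have "\<dots> \<le> (\<Sum>l<fst (\<omega> []). message \<beta> (ereal (next_field \<beta> g t (subtree l \<omega>))))"
  proof (rule sum_mono)
    fix l
    have good: "offspring_at_least n (subtree l \<omega>)" "\<And>v. ereal c \<le> g (snd (subtree l \<omega> v))"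
      using Suc.prems by (auto simp: offspring_at_least_subtree) (simp add: subtree_def)
    have "ereal c \<le> root_field \<beta> (\<lambda>_. \<infinity>) (Suc t) (subtree l \<omega>)"
      using \<beta> c good by (intro root_field_ge[where n = n]) auto
    then have "improved_factor \<beta> c r * message \<beta> (ereal (plus_field \<beta> t (subtree l \<omega>)))
        \<le> message \<beta> (ereal (r * plus_field \<beta> t (subtree l \<omega>)))"
      using \<beta> c r by (intro message_mult_ge) (auto simp: root_field_Suc simp del: root_field.simps)
    also have "\<dots> \<le> message \<beta> (ereal (next_field \<beta> g t (subtree l \<omega>)))"
      using Suc.IH[OF good] \<beta> by (intro message_mono) (auto simp: r_def)
    finally show "improved_factor \<beta> c r * message \<beta> (ereal (plus_field \<beta> t (subtree l \<omega>)))
        \<le> message \<beta> (ereal (next_field \<beta> g t (subtree l \<omega>)))" .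
  qed
  also have "\<dots> = next_field \<beta> g (Suc t) \<omega>"
    by (subst (2) next_field_def) (simp add: root_field_Suc del: root_field.simps)
  finally show ?case by (simp add: r_def)
qed

lemma next_field_tendsto_plus_limit:
  assumes \<beta>: "0 < \<beta>" and c: "0 < c" "c \<le> real n * message \<beta> (ereal c)"
    and \<omega>: "offspring_at_least n \<omega>" "\<And>v. ereal c \<le> g (snd (\<omega> v))"
  shows "(\<lambda>t. next_field \<beta> g t \<omega>) \<longlonglongrightarrow> plus_limit \<beta> \<omega>"
proof (rule tendsto_sandwich)
  let ?r = "\<lambda>t. (improved_factor \<beta> c ^^ t) (message \<beta> (ereal c) / \<beta>)"
  have "0 < message \<beta> (ereal c)"
    using c by (smt (verit) mult_nonneg_nonpos of_nat_0_le_iff)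
  then have "?r \<longlonglongrightarrow> 1"
    using \<beta> c message_le[of \<beta> "ereal c"] by (intro improved_factor_iterates_tendsto_1) auto
  from tendsto_mult[OF this plus_field_tendsto] \<beta>
  show "(\<lambda>t. ?r t * plus_field \<beta> t \<omega>) \<longlonglongrightarrow> plus_limit \<beta> \<omega>" by simp
  show "(\<lambda>t. plus_field \<beta> t \<omega>) \<longlonglongrightarrow> plus_limit \<beta> \<omega>"
    using \<beta> by (intro plus_field_tendsto) simp
  show "\<forall>\<^sub>F t in sequentially. ?r t * plus_field \<beta> t \<omega> \<le> next_field \<beta> g t \<omega>"
    using assms by (intro always_eventually allI next_field_ge_plus) auto
  have "next_field \<beta> g t \<omega> \<le> plus_field \<beta> t \<omega>" for t
    using root_field_le_plus[of \<beta> g "Suc t" \<omega>] \<beta> by (simp add: root_field_Suc del: root_field.simps)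
  then show "\<forall>\<^sub>F t in sequentially. next_field \<beta> g t \<omega> \<le> plus_field \<beta> t \<omega>" by simp
qed

lemma plus_limit_ge:
  assumes "0 \<le> \<beta>" "0 \<le> c" "c \<le> real n * message \<beta> (ereal c)" "offspring_at_least n \<omega>"
  shows "real n * message \<beta> (ereal c) \<le> plus_limit \<beta> \<omega>"
proof (rule LIMSEQ_le_const[OF plus_field_tendsto])
  show "\<exists>N. \<forall>t\<ge>N. real n * message \<beta> (ereal c) \<le> plus_field \<beta> t \<omega>"
    using assms offspring_at_least_subtree[OF assms(4)]
    by (intro exI allI impI next_field_ge root_field_ge[where n = n]) (auto simp: offspring_at_least_def)
qed fact

section \<open>From pointwise limits on the tree to convergence in law\<close>

lemma AE_tendsto_imp_weak_conv:
  fixes X :: "nat \<Rightarrow> 'a \<Rightarrow> real"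
  assumes "prob_space M"
    and X [measurable]: "\<And>n. X n \<in> borel_measurable M" and Y [measurable]: "Y \<in> borel_measurable M"
    and lim: "AE \<omega> in M. (\<lambda>n. X n \<omega>) \<longlonglongrightarrow> Y \<omega>"
  shows "weak_conv_m (\<lambda>n. distr M borel (X n)) (distr M borel Y)"
proof (rule integral_bdd_continuous_conv_imp_weak_conv)
  interpret prob_space M by fact
  show "real_distribution (distr M borel (X n))" for n by (rule real_distribution_distr) fact
  show "real_distribution (distr M borel Y)" by (rule real_distribution_distr) fact
  fix f :: "real \<Rightarrow> real"
  assume f: "\<And>x. isCont f x" "\<And>x. \<bar>f x\<bar> \<le> 1"
  have [measurable]: "f \<in> borel_measurable borel"
    using f(1) by (intro borel_measurable_continuous_onI continuous_at_imp_continuous_on) auto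
  have "(\<lambda>n. \<integral>\<omega>. f (X n \<omega>) \<partial>M) \<longlonglongrightarrow> (\<integral>\<omega>. f (Y \<omega>) \<partial>M)"
  proof (rule integral_dominated_convergence[where w = "\<lambda>_. 1"])
    show "AE \<omega> in M. (\<lambda>n. f (X n \<omega>)) \<longlonglongrightarrow> f (Y \<omega>)"
      using lim by eventually_elim (rule isCont_tendsto_compose[OF f(1)])
  qed (use f(2) in auto)
  then show "(\<lambda>n. integral\<^sup>L (distr M borel (X n)) f) \<longlonglongrightarrow> integral\<^sup>L (distr M borel Y) f"
    by (simp add: integral_distr)
qed

text \<open>
  Weak convergence determines the limit of the characteristic functions.
\<close>

lemma weak_limit_unique:
  assumes "\<And>n. real_distribution (M n)" "real_distribution L" "real_distribution L'"
    and "weak_conv_m M L" "weak_conv_m M L'"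
  shows "L = L'"
proof (rule Levy_uniqueness)
  show "char L = char L'"
    using assms by (intro ext LIMSEQ_unique[OF levy_continuity1 levy_continuity1, of M])
qed fact+

text \<open>
  The probability space on which recursions with offspring law \<open>P\<close> are coupled.
\<close>

locale recursion_tree =
  fixes P :: "nat pmf" and \<mu> :: "ereal measure"
  assumes prob_space_\<mu>: "prob_space \<mu>" and sets_\<mu> [measurable_cong]: "sets \<mu> = sets borel"
begin

abbreviation label_law :: "(nat \<times> ereal) measure" where
  "label_law \<equiv> measure_pmf (size_biased P) \<Otimes>\<^sub>M \<mu>"

lemma prob_space_label: "prob_space label_law"
proof -
  interpret pair_prob_space "measure_pmf (size_biased P)" \<mu>
    using prob_space_\<mu> by (simp add: pair_prob_space_def pair_sigma_finite_def
      prob_space_imp_sigma_finite measure_pmf.prob_space_axioms)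
  show ?thesis by unfold_locales
qed

lemma prob_space_tree: "prob_space (tree_space label_law)"
  by (intro prob_space_PiM prob_space_label)

lemma measurable_root_field [measurable]:
  assumes [measurable]: "g \<in> borel_measurable borel"
  shows "root_field \<beta> g t \<in> borel_measurable (tree_space label_law)"
proof (induction t)
  case 0
  show ?case by simp
next
  case (Suc t)
  note Suc [measurable]
  have "(\<lambda>\<omega>. \<Sum>l<k. message \<beta> (root_field \<beta> g t (subtree l \<omega>)))
      \<in> borel_measurable (tree_space label_law)" for k
    by measurable
  then have "(\<lambda>\<omega>. \<Sum>l<fst (\<omega> []). message \<beta> (root_field \<beta> g t (subtree l \<omega>)))
      \<in> borel_measurable (tree_space label_law)"
    by (rule measurable_compose_countable) measurable
  then show ?case by simp
qed

lemma measurable_next_field [measurable]: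
  assumes "g \<in> borel_measurable borel"
  shows "next_field \<beta> g t \<in> borel_measurable (tree_space label_law)"
  using measurable_root_field[OF assms, of \<beta> "Suc t"]
  by (simp add: root_field_Suc del: root_field.simps)

lemma measurable_plus_limit [measurable]:
  "plus_limit \<beta> \<in> borel_measurable (tree_space label_law)"
  unfolding plus_limit_def by measurable

lemma distr_label_fst: "distr label_law (measure_pmf (size_biased P)) fst = measure_pmf (size_biased P)"
  using prob_space_\<mu>  by (simp add: prob_space.distr_pair_fst)

lemma distr_label_snd: "distr label_law \<mu> snd = \<mu>"
proof (rule measure_eqI)
  interpret \<mu>: prob_space \<mu> by (rule prob_space_\<mu>)
  fix A assume "A \<in> sets (distr label_law \<mu> snd)"
  then have A: "A \<in> sets \<mu>" by simp
  have "snd -` A \<inter> space label_law = UNIV \<times> A"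
    using sets.sets_into_space[OF A] by (auto simp: space_pair_measure)
  with A show "emeasure (distr label_law \<mu> snd) A = emeasure \<mu> A"
    using measure_pmf.emeasure_space_1[of "size_biased P"]
    by (simp add: emeasure_distr \<mu>.emeasure_pair_measure_Times)
qed simp

text \<open>
  By self-similarity, applying a function of the tree to the subtrees at the root yields the i.i.d.
  fields of the recursion, independent of the number of offspring of the root.
\<close>

lemma recursion_step_distr:
  assumes [measurable]: "X \<in> borel_measurable (tree_space label_law)"
  shows "recursion_step P \<beta> (distr (tree_space label_law) borel X)
       = distr (tree_space label_law) borel
           (\<lambda>\<omega>. \<Sum>l<fst (\<omega> []). message \<beta> (X (subtree l \<omega>)))"
proof -
  let ?T = "tree_space label_law" and ?K = "measure_pmf (size_biased P)"
  let ?N = "\<Pi>\<^sub>M l\<in>(UNIV :: nat set). (borel :: ereal measure)"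
  let ?S = "\<lambda>(k, h). \<Sum>l<k. message \<beta> (h l)"
  have "(\<lambda>x. \<Sum>l<k. message \<beta> (snd x l)) \<in> borel_measurable (?K \<Otimes>\<^sub>M ?N)" for k
    by measurable
  then have "(\<lambda>x. \<Sum>l<fst x. message \<beta> (snd x l)) \<in> borel_measurable (?K \<Otimes>\<^sub>M ?N)"
    by (rule measurable_compose_countable) measurable
  then have S [measurable]: "?S \<in> borel_measurable (?K \<Otimes>\<^sub>M ?N)"
    by (simp add: case_prod_beta')
  have child: "(\<lambda>\<omega>. X (subtree l \<omega>)) \<in> borel_measurable ?T" for l
    by measurable
  have pair: "(\<lambda>\<omega>. (fst (\<omega> []), \<lambda>l. X (subtree l \<omega>))) \<in> ?T \<rightarrow>\<^sub>M ?K \<Otimes>\<^sub>M ?N"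
    by (intro measurable_Pair measurable_PiM_single' child) (auto, measurable)
  have "recursion_step P \<beta> (distr ?T borel X)
      = distr (?K \<Otimes>\<^sub>M (\<Pi>\<^sub>M l\<in>(UNIV :: nat set). distr ?T borel X)) borel ?S"
    by (simp add: recursion_step_def message_def)
  also have "?K \<Otimes>\<^sub>M (\<Pi>\<^sub>M l\<in>(UNIV :: nat set). distr ?T borel X)
      = distr ?T (?K \<Otimes>\<^sub>M ?N) (\<lambda>\<omega>. (fst (\<omega> []), \<lambda>l. X (subtree l \<omega>)))"
    using distr_root_subtrees[OF prob_space_label, of fst ?K X borel]
    by (simp add: distr_label_fst)
  also have "distr \<dots> borel ?S = distr ?T borel (\<lambda>\<omega>. \<Sum>l<fst (\<omega> []). message \<beta> (X (subtree l \<omega>)))"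
    by (subst distr_distr[OF S pair]) (simp add: o_def)
  finally show ?thesis .
qed

lemma field_law_eq_distr:
  assumes [measurable]: "g \<in> borel_measurable borel"
  shows "field_law P \<beta> (distr \<mu> borel g) t = distr (tree_space label_law) borel (root_field \<beta> g t)"
proof (induction t)
  case 0
  have "distr (tree_space label_law) borel (\<lambda>\<omega>. g (snd (\<omega> [])))
      = distr (distr (distr (tree_space label_law) label_law (\<lambda>\<omega>. \<omega> [])) \<mu> snd) borel g"
    by (simp add: distr_distr o_def)
  also have "distr (tree_space label_law) label_law (\<lambda>\<omega>. \<omega> []) = label_law"
    using prob_space_label by (intro distr_PiM_component) auto
  finally show ?case by (simp add: distr_label_snd)
next
  case (Suc t)
  then show ?case
    by (simp add: recursion_step_distr distr_distr o_def flip: next_field_def)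
qed

lemma recursion_step_eq_distr:
  assumes "g \<in> borel_measurable borel"
  shows "recursion_step P \<beta> (field_law P \<beta> (distr \<mu> borel g) t)
       = distr (tree_space label_law) borel (next_field \<beta> g t)"
  using assms by (simp add: field_law_eq_distr recursion_step_distr flip: next_field_def)

lemma recursion_tendsto_plus_limit:
  assumes [measurable]: "g \<in> borel_measurable borel"
    and "AE \<omega> in tree_space label_law. (\<lambda>t. next_field \<beta> g t \<omega>) \<longlonglongrightarrow> plus_limit \<beta> \<omega>"
  shows "recursion_tendsto P \<beta> (distr \<mu> borel g)
           (distr (tree_space label_law) borel (plus_limit \<beta>))"
  unfolding recursion_tendsto_def recursion_step_eq_distr[OF assms(1)]
  using assms
  by (intro conjI AE_tendsto_imp_weak_conv prob_space_tree
      prob_space.real_distribution_distr[OF prob_space_tree]) auto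

lemma recursion_tendsto_unique:
  assumes [measurable]: "g \<in> borel_measurable borel"
    and "recursion_tendsto P \<beta> (distr \<mu> borel g) L" "recursion_tendsto P \<beta> (distr \<mu> borel g) L'"
  shows "L = L'"
proof (rule weak_limit_unique)
  show "real_distribution (recursion_step P \<beta> (field_law P \<beta> (distr \<mu> borel g) t))" for t
    unfolding recursion_step_eq_distr[OF assms(1)]
    by (intro prob_space.real_distribution_distr[OF prob_space_tree]) auto
qed (use assms in \<open>auto simp: recursion_tendsto_def\<close>)

lemma distr_const_infty: "distr \<mu> borel (\<lambda>_. \<infinity>) = return borel \<infinity>"
  by (rule prob_space.distr_const[OF prob_space_\<mu>]) simp

lemma plus_recursion_tendsto:
  assumes "0 \<le> \<beta>"
  shows "recursion_tendsto P \<beta> (return borel \<infinity>)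
           (distr (tree_space label_law) borel (plus_limit \<beta>))"
  using recursion_tendsto_plus_limit[of "\<lambda>_. \<infinity>"] plus_field_tendsto[OF assms]
  by (simp add: distr_const_infty)

lemma ex1_plus_limit:
  assumes "0 \<le> \<beta>"
  shows "\<exists>!L. recursion_tendsto P \<beta> (return borel \<infinity>) L"
  using plus_recursion_tendsto[OF assms] recursion_tendsto_unique[of "\<lambda>_. \<infinity>" \<beta>]
  by (auto simp: distr_const_infty)

lemma plus_law_eq_distr:
  assumes "0 \<le> \<beta>"
  shows "plus_law P \<beta> = distr (tree_space label_law) borel (plus_limit \<beta>)"
  unfolding plus_law_def
  using ex1_plus_limit[OF assms] plus_recursion_tendsto[OF assms] by (rule the1_equality)

lemma AE_offspring_at_least:
  assumes "\<And>k. k \<in> set_pmf (size_biased P) \<Longrightarrow> n \<le> k"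
  shows "AE \<omega> in tree_space label_law. offspring_at_least n \<omega>"
proof -
  have "AE k in distr label_law (measure_pmf (size_biased P)) fst. n \<le> k"
    unfolding distr_label_fst AE_measure_pmf_iff using assms by blast
  then have "AE x in label_law. n \<le> fst x"
    by (simp add: AE_distr_iff)
  then have "AE \<omega> in tree_space label_law. n \<le> fst (\<omega> v)" for v
    by (intro AE_PiM_component prob_space_label) auto
  then show ?thesis unfolding offspring_at_least_def by (simp add: AE_all_countable)
qed

lemma AE_initial_values:
  assumes "AE x in \<mu>. p x" and [measurable]: "Measurable.pred borel p"
  shows "AE \<omega> in tree_space label_law. \<forall>v. p (snd (\<omega> v))"
proof -
  have "AE x in label_law. p (snd x)"
    using assms(1) by (subst (asm) distr_label_snd[symmetric]) (simp add: AE_distr_iff)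
  then have "AE \<omega> in tree_space label_law. p (snd (\<omega> v))" for v
    by (intro AE_PiM_component prob_space_label) auto
  then show ?thesis by (simp add: AE_all_countable)
qed

text \<open>
  Passing to the limit keeps only the weak bound by \<open>n * f c\<close>; the strict inequality comes from the
  gap between \<open>c\<close> and \<open>n * f c\<close>.
\<close>

lemma plus_law_support:
  assumes "0 \<le> \<beta>" "0 \<le> c" "c < real n * message \<beta> (ereal c)"
    and "\<And>k. k \<in> set_pmf (size_biased P) \<Longrightarrow> n \<le> k"
  shows "measure (plus_law P \<beta>) {c<..} = 1"
proof -
  interpret T: prob_space "tree_space label_law" by (rule prob_space_tree)
  have "AE \<omega> in tree_space label_law. offspring_at_least n \<omega>"
    using assms(4) by (rule AE_offspring_at_least)
  then have "AE \<omega> in tree_space label_law. c < plus_limit \<beta> \<omega>"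
    by eventually_elim (use plus_limit_ge[of \<beta> c n] assms(1-3) in force)
  then have "T.prob {\<omega> \<in> space (tree_space label_law). c < plus_limit \<beta> \<omega>} = 1"
    by (subst T.prob_Collect_eq_1) auto
  then show ?thesis
    by (simp add: plus_law_eq_distr assms measure_distr vimage_def Int_def conj_commute)
qed

lemma recursion_tendsto_plus_law:
  assumes "0 < \<beta>" "0 < c" "c \<le> real n * message \<beta> (ereal c)"
    and "\<And>k. k \<in> set_pmf (size_biased P) \<Longrightarrow> n \<le> k"
    and \<mu>: "AE x in \<mu>. ereal c \<le> x"
  shows "recursion_tendsto P \<beta> \<mu> (plus_law P \<beta>)"
proof -
  have "AE \<omega> in tree_space label_law. offspring_at_least n \<omega>"
    using assms(4) by (rule AE_offspring_at_least)
  moreover have "AE \<omega> in tree_space label_law. \<forall>v. ereal c \<le> snd (\<omega> v)"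
    using \<mu> by (rule AE_initial_values) simp
  ultimately have "AE \<omega> in tree_space label_law.
      (\<lambda>t. next_field \<beta> (\<lambda>x. x) t \<omega>) \<longlonglongrightarrow> plus_limit \<beta> \<omega>"
    by eventually_elim (rule next_field_tendsto_plus_limit[OF assms(1-3)], auto)
  from recursion_tendsto_plus_limit[OF _ this] show ?thesis
    using assms(1) distr_id2[of borel \<mu>] by (simp add: plus_law_eq_distr sets_\<mu>)
qed

end

lemma stoch_dominates_AE_gt:
  assumes "prob_space \<mu>" "sets \<mu> = sets borel" "sets L = sets borel"
    and "stoch_dominates \<mu> (distr L borel ereal)" "measure L {c<..} = 1"
  shows "AE x in \<mu>. ereal c < x"
proof -
  interpret prob_space \<mu> by fact
  note [measurable_cong] = assms(2,3)
  have "ereal -` {ereal c<..} \<inter> space L = {c<..}"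
    using sets_eq_imp_space_eq[OF assms(3)] by auto
  then have "1 \<le> prob {ereal c<..}"
    using assms(4,5) spec[of _ "ereal c"] by (simp add: stoch_dominates_def measure_distr) metis
  then have "prob {ereal c<..} = 1" by (intro antisym prob_le_1)
  then show ?thesis
    using prob_eq_1[of "{ereal c<..}"] assms(2) by simp
qed

text \<open>
  The ordering of the two parameters enters only through the level \<open>c\<close>: it is chosen at \<open>\<beta>\<^sub>0\<close>, where
  it bounds the initial field from below, and is kept at \<open>\<beta>\<close>, where \<open>f\<close> is larger.
\<close>

theorem lemma1p18:
  fixes P :: "nat pmf" and d_star :: nat and \<beta>_star :: real
  assumes finite_mean: "integrable (measure_pmf P) real"
    and "3 \<le> d_star"
    and min_degree: "measure_pmf.prob P {0..<d_star} = 0"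
    and \<beta>_star: "\<beta>_star = artanh (1 / (real d_star - 1))"
  shows
    "(\<forall>\<beta>c \<beta>. ising_critical P \<beta>c \<and> \<beta>c < \<beta> \<longrightarrow>
        (\<exists>!L. recursion_tendsto P \<beta> (return borel \<infinity>) L)) \<and>
     (\<forall>\<beta>>\<beta>_star. \<exists>!L. recursion_tendsto P \<beta> (return borel \<infinity>) L) \<and>
     (\<forall>\<beta>\<^sub>0 \<beta> \<mu>. \<beta>_star < \<beta>\<^sub>0 \<and> \<beta>\<^sub>0 \<le> \<beta> \<and>
        prob_space \<mu> \<and> sets \<mu> = sets borel \<and>
        stoch_dominates \<mu> (distr (plus_law P \<beta>\<^sub>0) borel ereal) \<longrightarrow>
        recursion_tendsto P \<beta> \<mu> (plus_law P \<beta>))"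
proof -
  interpret I: recursion_tree P "return borel \<infinity>"
    by (intro recursion_tree.intro prob_space_return) auto
  define n where "n = d_star - 1"
  have n: "real n = real d_star - 1" "2 \<le> n"
    using \<open>3 \<le> d_star\<close> by (auto simp: n_def)
  have offspring: "n \<le> k" if "k \<in> set_pmf (size_biased P)" for k
    using size_biased_support[OF finite_mean min_degree _ that] \<open>3 \<le> d_star\<close> by (simp add: n_def)
  have "0 \<le> \<beta>_star"
    using artanh_mono[of 0 "1 / real n"] n by (simp add: \<beta>_star)
  have "recursion_tendsto P \<beta> \<mu> (plus_law P \<beta>)"
    if \<beta>: "\<beta>_star < \<beta>\<^sub>0" "\<beta>\<^sub>0 \<le> \<beta>" and \<mu>: "prob_space \<mu>" "sets \<mu> = sets borel"
      and dom: "stoch_dominates \<mu> (distr (plus_law P \<beta>\<^sub>0) borel ereal)" for \<beta>\<^sub>0 \<beta> \<mu>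
  proof -
    interpret M: recursion_tree P \<mu>
      using \<mu> by (intro recursion_tree.intro)
    have "1 / real n < tanh \<beta>\<^sub>0"
      using tanh_gt_of_gt_artanh[of "1 / real n" \<beta>\<^sub>0] \<beta> n by (simp add: \<beta>_star)
    then have "1 < real n * tanh \<beta>\<^sub>0"
      using n(2) by (simp add: divide_less_eq mult.commute)
    then obtain c where c: "0 < c" "c < real n * message \<beta>\<^sub>0 (ereal c)"
      by (rule supercritical_branching_level)
    have "measure (plus_law P \<beta>\<^sub>0) {c<..} = 1"
      using \<beta> c \<open>0 \<le> \<beta>_star\<close> by (intro I.plus_law_support[of _ _ n] offspring) auto
    then have "AE x in \<mu>. ereal c < x"
      using \<mu> dom \<beta> \<open>0 \<le> \<beta>_star\<close>
      by (intro stoch_dominates_AE_gt[of \<mu> "plus_law P \<beta>\<^sub>0"]) (auto simp: I.plus_law_eq_distr)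
    then have "AE x in \<mu>. ereal c \<le> x" by (rule AE_mp) (auto intro: less_imp_le)
    moreover have "c \<le> real n * message \<beta> (ereal c)"
    proof -
      have "c \<le> real n * message \<beta>\<^sub>0 (ereal c)" using c by simp
      also have "\<dots> \<le> real n * message \<beta> (ereal c)"
        using \<beta> c by (intro mult_left_mono message_mono_temperature) auto
      finally show ?thesis .
    qed
    ultimately show ?thesis
      using \<beta> c \<open>0 \<le> \<beta>_star\<close> by (intro M.recursion_tendsto_plus_law[of _ c n] offspring) auto
  qed
  moreover have "\<exists>!L. recursion_tendsto P \<beta> (return borel \<infinity>) L"
    if "ising_critical P \<beta>c" "\<beta>c < \<beta>" for \<beta>c \<beta>
    using that by (intro I.ex1_plus_limit) (simp add: ising_critical_def)
  moreover have "\<exists>!L. recursion_tendsto P \<beta> (return borel \<infinity>) L" if "\<beta>_star < \<beta>" for \<beta>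
    using that \<open>0 \<le> \<beta>_star\<close> by (intro I.ex1_plus_limit) simp
  ultimately show ?thesis by blast
qed

end
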